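(* Let $k$ be an algebraically closed field of characteristic $p$ (possibly $p=0$). For each $n\ge 1$ and $r\ge 1$, if $p$ does not divide $n$, then there is an isomorphism of varieties $\varphi: C_r(\mathfrak{gl}_n)\to C_r(\mathfrak{sl}_n)\times\mathbb{A}^r$ defined by $$\varphi:(v_1,\ldots,v_r)\mapsto\left(v_1-\frac{\mathrm{Tr}(v_1)}{n}I_n,\ldots,v_r-\frac{\mathrm{Tr}(v_r)}{n}I_n\right)\times\left(\mathrm{Tr}(v_1),\ldots,\mathrm{Tr}(v_r)\right)$$ for $v_i\in\mathfrak{gl}_n$.
   Context: For a Lie algebra $\mathfrak{g}$ over $k$, $C_r(\mathfrak{g})=\{(v_1,\ldots,v_r)\in\mathfrak{g}^r\mid [v_i,v_j]=0\text{ for all }i,j\}$, a closed subvariety of $\mathfrak{g}^r$ (with reduced structure). $I_n$ is the $n\times n$ identity matrix. When $p=0$ the condition "$p$ does not divide $n$" is automatically satisfied (i.e. the hypothesis is that $n$ is invertible in $k$). *)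

theory Defs
  imports "HOL-Analysis.Determinants" "HOL-Library.Poly_Mapping"
    "HOL-Computational_Algebra.Polynomial"
begin

section \<open>Affine varieties and their morphisms\<close>

text \<open>
  A polynomial in variables indexed by \<^typ>\<open>'i\<close> is a finitely supported map from monomials
  (finitely supported exponent vectors) to coefficients.
\<close>

type_synonym ('i, 'k) polynomial = "('i \<Rightarrow>\<^sub>0 nat) \<Rightarrow>\<^sub>0 'k"

definition poly_eval :: "('i, 'k::comm_semiring_1) polynomial \<Rightarrow> ('i \<Rightarrow> 'k) \<Rightarrow> 'k" where
  "poly_eval p x =
    (\<Sum>m\<in>Poly_Mapping.keys p. Poly_Mapping.lookup p m *
       (\<Prod>i\<in>Poly_Mapping.keys m. x i ^ Poly_Mapping.lookup m i))"

definition zariski_closed :: "('i \<Rightarrow> 'k::comm_semiring_1) set \<Rightarrow> bool" where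
  "zariski_closed X \<longleftrightarrow> (\<exists>S :: ('i, 'k) polynomial set. X = {x. \<forall>p\<in>S. poly_eval p x = 0})"

text \<open>
  A classical (reduced, not necessarily irreducible) affine variety over an algebraically closed
  field is given by its set of points together with a coordinate map that identifies this set
  with a Zariski closed subset of the affine space of functions from the finite type \<^typ>\<open>'i\<close>
  to \<^typ>\<open>'k\<close>.
\<close>

record ('v, 'i, 'k) variety =
  points :: "'v set"
  coord :: "'v \<Rightarrow> 'i \<Rightarrow> 'k"

definition affine_variety :: "('v, 'i::finite, 'k::alg_closed_field) variety \<Rightarrow> bool" where
  "affine_variety V \<longleftrightarrow> inj_on (coord V) (points V) \<and> zariski_closed (coord V ` points V)"

definition morphism ::
  "('v, 'i::finite, 'k::alg_closed_field) variety \<Rightarrow> ('w, 'j::finite, 'k) variety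
    \<Rightarrow> ('v \<Rightarrow> 'w) \<Rightarrow> bool" where
  "morphism V W f \<longleftrightarrow>
     (\<forall>v\<in>points V. f v \<in> points W) \<and>
     (\<exists>P :: 'j \<Rightarrow> ('i, 'k) polynomial.
        \<forall>v\<in>points V. \<forall>j. coord W (f v) j = poly_eval (P j) (coord V v))"

definition variety_isomorphism ::
  "('v, 'i::finite, 'k::alg_closed_field) variety \<Rightarrow> ('w, 'j::finite, 'k) variety
    \<Rightarrow> ('v \<Rightarrow> 'w) \<Rightarrow> bool" where
  "variety_isomorphism V W f \<longleftrightarrow>
     affine_variety V \<and> affine_variety W \<and> morphism V W f \<and>
     (\<exists>g. morphism W V g \<and> (\<forall>v\<in>points V. g (f v) = v) \<and> (\<forall>w\<in>points W. f (g w) = w))"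

definition affine_space :: "('k ^ 'r, 'r::finite, 'k) variety" where
  "affine_space = \<lparr>points = UNIV, coord = ($)\<rparr>"

definition variety_prod ::
  "('v, 'i, 'k) variety \<Rightarrow> ('w, 'j, 'k) variety \<Rightarrow> ('v \<times> 'w, 'i + 'j, 'k) variety"
  (infixr \<open>\<times>\<^sub>V\<close> 80) where
  "V \<times>\<^sub>V W =
     \<lparr>points = points V \<times> points W, coord = (\<lambda>(v, w). case_sum (coord V v) (coord W w))\<rparr>"


section \<open>Commuting varieties of matrix Lie algebras\<close>

definition gl :: "('k::field ^ 'n ^ 'n) set" where
  "gl = UNIV"

definition sl :: "('k::field ^ 'n ^ 'n) set" where
  "sl = {A. trace A = 0}"

definition lie_bracket :: "'k::field ^ 'n ^ 'n \<Rightarrow> 'k ^ 'n ^ 'n \<Rightarrow> 'k ^ 'n ^ 'n" where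
  "lie_bracket A B = A ** B - B ** A"

text \<open>
  For a Lie subalgebra \<open>\<gg>\<close> of the \<open>n \<times> n\<close> matrices, the commuting variety of \<open>r\<close>-tuples in \<open>\<gg>\<close>;
  here \<open>n\<close> and \<open>r\<close> are the cardinalities of the (nonempty) finite index types \<^typ>\<open>'n\<close> and
  \<^typ>\<open>'r\<close>. Its coordinates are all matrix entries of all components.
\<close>

definition commuting_variety ::
  "('k::field ^ 'n ^ 'n) set \<Rightarrow> ('k ^ 'n ^ 'n ^ 'r, 'r \<times> 'n \<times> 'n, 'k) variety" where
  "commuting_variety \<gg> =
     \<lparr>points = {v. (\<forall>i. v $ i \<in> \<gg>) \<and> (\<forall>i j. lie_bracket (v $ i) (v $ j) = 0)},
      coord = (\<lambda>v (l, i, j). v $ l $ i $ j)\<rparr>"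

definition trace_splitting ::
  "'k::field ^ 'n ^ 'n ^ 'r \<Rightarrow> ('k ^ 'n ^ 'n ^ 'r) \<times> ('k ^ 'r)" where
  "trace_splitting v =
     ((\<chi> i. v $ i - map_matrix ((*) (trace (v $ i) / of_nat CARD('n))) (mat 1)),
      (\<chi> i. trace (v $ i)))"

end

theory Submission
  imports Defs
begin

text \<open>
  Scalar matrices are central, so subtracting them does not change brackets. Since \<open>n\<close> is
  invertible, the splitting has the inverse \<open>(w, t) \<mapsto> (w\<^sub>i + (t\<^sub>i / n) I)\<^sub>i\<close>. Both maps are linear,
  and the commuting varieties are cut out by quadratic and linear equations, so everything reduces
  to the fact that polynomial functions form an algebra containing the coordinates.
\<close>

section \<open>Polynomial functions\<close>

definition monomial_eval :: "('i \<Rightarrow>\<^sub>0 nat) \<Rightarrow> ('i \<Rightarrow> 'k::comm_semiring_1) \<Rightarrow> 'k" where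
  "monomial_eval m x = (\<Prod>i\<in>Poly_Mapping.keys m. x i ^ Poly_Mapping.lookup m i)"

text \<open>Indices outside the support have exponent 0 and contribute the factor 1, so two
  monomials can be evaluated over one common index set.\<close>

lemma monomial_eval_superset:
  assumes "finite A" "Poly_Mapping.keys m \<subseteq> A"
  shows "monomial_eval m x = (\<Prod>i\<in>A. x i ^ Poly_Mapping.lookup m i)"
  unfolding monomial_eval_def
  by (rule prod.mono_neutral_left) (use assms in \<open>auto simp: in_keys_iff\<close>)

lemma monomial_eval_0 [simp]: "monomial_eval 0 x = 1"
  by (simp add: monomial_eval_def)

lemma monomial_eval_single [simp]: "monomial_eval (Poly_Mapping.single i e) x = x i ^ e"
  by (simp add: monomial_eval_superset[of "{i}"])

lemma monomial_eval_add: "monomial_eval (m + n) x = monomial_eval m x * monomial_eval n x"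
proof -
  let ?A = "Poly_Mapping.keys m \<union> Poly_Mapping.keys n"
  have "Poly_Mapping.keys (m + n) \<subseteq> ?A"
    by (rule Poly_Mapping.keys_add)
  then show ?thesis
    by (simp add: monomial_eval_superset[of ?A] lookup_add power_add prod.distrib)
qed

text \<open>Padding with zero coefficients gives a common range of summation; the support of
  \<open>p + q\<close> may shrink by cancellation.\<close>

lemma poly_eval_superset:
  assumes "finite A" "Poly_Mapping.keys p \<subseteq> A"
  shows "poly_eval p x = (\<Sum>m\<in>A. Poly_Mapping.lookup p m * monomial_eval m x)"
  unfolding poly_eval_def monomial_eval_def[symmetric]
  by (rule sum.mono_neutral_left) (use assms in \<open>auto simp: in_keys_iff\<close>)

lemma poly_eval_0 [simp]: "poly_eval 0 x = 0"
  by (simp add: poly_eval_def)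

lemma poly_eval_single [simp]:
  "poly_eval (Poly_Mapping.single m c) x = c * monomial_eval m x"
  by (simp add: poly_eval_superset[of "{m}"])

lemma poly_eval_add: "poly_eval (p + q) x = poly_eval p x + poly_eval q x"
proof -
  let ?A = "Poly_Mapping.keys p \<union> Poly_Mapping.keys q"
  have "Poly_Mapping.keys (p + q) \<subseteq> ?A"
    by (rule Poly_Mapping.keys_add)
  then show ?thesis
    by (simp add: poly_eval_superset[of ?A] lookup_add distrib_right sum.distrib)
qed

text \<open>Updating a fresh key amounts to adding a single term. In this form the induction step
  matches distributivity and the additivity of evaluation.\<close>

lemma poly_mapping_add_single_induct [case_names zero add_single]:
  fixes p :: "'a \<Rightarrow>\<^sub>0 'b::comm_monoid_add"
  assumes "P 0" "\<And>m c q. P q \<Longrightarrow> P (Poly_Mapping.single m c + q)"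
  shows "P p"
proof (induction p rule: Poly_Mapping.update_induct)
  case const
  show ?case by (rule assms(1))
next
  case (update q m c)
  have "Poly_Mapping.update m c q = Poly_Mapping.single m c + q"
    using update.hyps
    by (intro poly_mapping_eqI) (auto simp: lookup_update lookup_add lookup_single in_keys_iff)
  then show ?case
    using assms(2) update.IH by metis
qed

text \<open>By distributivity in \<open>q\<close> this reduces to a product of two terms, where
  coefficients multiply and exponents add. The general product then follows by the same induction on
  the left factor.\<close>

lemma poly_eval_single_mult:
  "poly_eval (Poly_Mapping.single m c * q) x = c * monomial_eval m x * poly_eval q x"
  by (induction q rule: poly_mapping_add_single_induct)
    (simp_all add: mult_single monomial_eval_add distrib_left poly_eval_add mult_ac)

lemma poly_eval_mult: "poly_eval (p * q) x = poly_eval p x * poly_eval q x"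
  by (induction p rule: poly_mapping_add_single_induct)
    (simp_all add: poly_eval_single_mult distrib_right poly_eval_add)

text \<open>Hiding the representing polynomial behind an existential makes polynomiality provable by
  closure rules, without ever writing a polynomial down.\<close>

definition polynomial_fun :: "(('i \<Rightarrow> 'k::comm_semiring_1) \<Rightarrow> 'k) \<Rightarrow> bool" where
  "polynomial_fun f \<longleftrightarrow> (\<exists>p. poly_eval p = f)"

section \<open>Closure properties of polynomial functions\<close>

named_theorems polynomial_fun_intros

lemma polynomial_fun_poly_eval: "polynomial_fun (poly_eval p)"
  by (auto simp: polynomial_fun_def)

lemma polynomial_fun_const [polynomial_fun_intros]: "polynomial_fun (\<lambda>x. c)"
  unfolding polynomial_fun_def by (rule exI[of _ "Poly_Mapping.single 0 c"]) auto

lemma polynomial_fun_coord [polynomial_fun_intros]: "polynomial_fun (\<lambda>x. x i)"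
  unfolding polynomial_fun_def
  by (rule exI[of _ "Poly_Mapping.single (Poly_Mapping.single i 1) 1"]) auto

lemma polynomial_fun_add [polynomial_fun_intros]:
  assumes "polynomial_fun f" "polynomial_fun g"
  shows "polynomial_fun (\<lambda>x. f x + g x)"
proof -
  obtain p q where "f = poly_eval p" "g = poly_eval q"
    using assms by (auto simp: polynomial_fun_def)
  then have "poly_eval (p + q) = (\<lambda>x. f x + g x)"
    by (simp add: fun_eq_iff poly_eval_add)
  then show ?thesis
    by (auto simp: polynomial_fun_def)
qed

lemma polynomial_fun_mult [polynomial_fun_intros]:
  assumes "polynomial_fun f" "polynomial_fun g"
  shows "polynomial_fun (\<lambda>x. f x * g x)"
proof -
  obtain p q where "f = poly_eval p" "g = poly_eval q"
    using assms by (auto simp: polynomial_fun_def)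
  then have "poly_eval (p * q) = (\<lambda>x. f x * g x)"
    by (simp add: fun_eq_iff poly_eval_mult)
  then show ?thesis
    by (auto simp: polynomial_fun_def)
qed

lemma polynomial_fun_diff [polynomial_fun_intros]:
  fixes f g :: "('i \<Rightarrow> 'k::comm_ring_1) \<Rightarrow> 'k"
  assumes "polynomial_fun f" "polynomial_fun g"
  shows "polynomial_fun (\<lambda>x. f x - g x)"
proof -
  have "polynomial_fun (\<lambda>x. f x + (- 1) * g x)"
    by (intro polynomial_fun_add polynomial_fun_mult polynomial_fun_const assms)
  then show ?thesis
    by simp
qed

lemma polynomial_fun_divide [polynomial_fun_intros]:
  fixes f :: "('i \<Rightarrow> 'k::field) \<Rightarrow> 'k"
  assumes "polynomial_fun f"
  shows "polynomial_fun (\<lambda>x. f x / c)"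
proof -
  have "polynomial_fun (\<lambda>x. f x * inverse c)"
    by (intro polynomial_fun_mult polynomial_fun_const assms)
  then show ?thesis
    by (simp add: field_class.field_divide_inverse)
qed

lemma polynomial_fun_sum [polynomial_fun_intros]:
  assumes "\<And>a. a \<in> A \<Longrightarrow> polynomial_fun (f a)"
  shows "polynomial_fun (\<lambda>x. \<Sum>a\<in>A. f a x)"
  using assms
  by (induction A rule: infinite_finite_induct) (auto intro: polynomial_fun_intros)

lemma polynomial_fun_prod [polynomial_fun_intros]:
  assumes "\<And>a. a \<in> A \<Longrightarrow> polynomial_fun (f a)"
  shows "polynomial_fun (\<lambda>x. \<Prod>a\<in>A. f a x)"
  using assms
  by (induction A rule: infinite_finite_induct) (auto intro: polynomial_fun_intros)

lemma polynomial_fun_power [polynomial_fun_intros]: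
  assumes "polynomial_fun f"
  shows "polynomial_fun (\<lambda>x. f x ^ e)"
  using assms by (induction e) (auto intro: polynomial_fun_intros)

text \<open>Evaluation is a finite sum of products of powers of coordinates, and each coordinate is
  replaced by a polynomial function.\<close>

lemma polynomial_fun_compose:
  assumes "polynomial_fun f" "\<And>i. polynomial_fun (\<lambda>z. h z i)"
  shows "polynomial_fun (\<lambda>z. f (h z))"
proof -
  obtain p where "f = poly_eval p"
    using assms(1) by (auto simp: polynomial_fun_def)
  then show ?thesis
    unfolding poly_eval_def by (auto intro!: polynomial_fun_intros assms(2))
qed


section \<open>Closed sets, products and morphisms\<close>

text \<open>As defining equations one takes all polynomials whose evaluation lies in
  \<open>F\<close>; no representatives have to be chosen.\<close>

lemma zariski_closedI:
  assumes "\<And>f. f \<in> F \<Longrightarrow> polynomial_fun f" "X = {x. \<forall>f\<in>F. f x = 0}"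
  shows "zariski_closed X"
proof -
  have "X = {x. \<forall>p\<in>{p. poly_eval p \<in> F}. poly_eval p x = 0}"
    using assms by (auto simp: polynomial_fun_def)
  then show ?thesis
    unfolding zariski_closed_def by blast
qed

lemma zariski_closed_zeros:
  assumes "polynomial_fun f"
  shows "zariski_closed {x. f x = 0}"
  using assms by (intro zariski_closedI[of "{f}"]) auto

text \<open>An arbitrary intersection is cut out by the union of systems of equations chosen for its
  members.\<close>

lemma zariski_closed_Inter:
  assumes "\<And>X. X \<in> \<X> \<Longrightarrow> zariski_closed X"
  shows "zariski_closed (\<Inter>\<X>)"
proof -
  have "\<forall>X\<in>\<X>. \<exists>S. X = {x. \<forall>p\<in>S. poly_eval p x = 0}"
    using assms unfolding zariski_closed_def by blast
  from bchoice[OF this] obtain S where S: "\<forall>X\<in>\<X>. X = {x. \<forall>p\<in>S X. poly_eval p x = 0}"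
    ..
  have "x \<in> X \<longleftrightarrow> (\<forall>p\<in>S X. poly_eval p x = 0)" if "X \<in> \<X>" for x X
    using bspec[OF S that] by (simp add: set_eq_iff)
  then have "\<Inter>\<X> = {x. \<forall>p\<in>\<Union>(S ` \<X>). poly_eval p x = 0}"
    by (auto simp: Inter_iff)
  then show ?thesis
    unfolding zariski_closed_def by blast
qed

lemma zariski_closed_UNIV: "zariski_closed UNIV"
  using zariski_closed_Inter[of "{}"] by simp

lemma zariski_closed_Int:
  assumes "zariski_closed X" "zariski_closed Y"
  shows "zariski_closed (X \<inter> Y)"
  using zariski_closed_Inter[of "{X, Y}"] assms by auto

lemma zariski_closed_all:
  assumes "\<And>a. zariski_closed {x. P a x}"
  shows "zariski_closed {x. \<forall>a. P a x}"
  using zariski_closed_Inter[of "range (\<lambda>a. {x. P a x})"] assms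
  by (auto simp: Collect_all_eq)

lemma zariski_closed_conj:
  assumes "zariski_closed {x. P x}" "zariski_closed {x. Q x}"
  shows "zariski_closed {x. P x \<and> Q x}"
  using zariski_closed_Int[OF assms] by (simp add: Collect_conj_eq)

text \<open>Equations of \<open>X\<close> pull back along the polynomial map \<open>h\<close> to
  polynomial equations of the preimage.\<close>

lemma zariski_closed_vimage:
  assumes "zariski_closed X" "\<And>i. polynomial_fun (\<lambda>z. h z i)"
  shows "zariski_closed (h -` X)"
proof -
  obtain S where "X = {x. \<forall>p\<in>S. poly_eval p x = 0}"
    using assms(1) by (auto simp: zariski_closed_def)
  then have "h -` X = {z. \<forall>f\<in>(\<lambda>p z. poly_eval p (h z)) ` S. f z = 0}"
    by simp
  moreover have "polynomial_fun (\<lambda>z. poly_eval p (h z))" for p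
    by (rule polynomial_fun_compose[OF polynomial_fun_poly_eval assms(2)])
  ultimately show ?thesis
    by (intro zariski_closedI[of "(\<lambda>p z. poly_eval p (h z)) ` S"]) blast
qed

section \<open>Affine spaces and products are affine varieties\<close>

lemma affine_variety_affine_space:
  "affine_variety (affine_space :: ('k::alg_closed_field ^ 'r::finite, 'r, 'k) variety)"
proof -
  have "range (($) :: 'k ^ 'r \<Rightarrow> _) = UNIV"
    by (rule surjI[of _ vec_lambda]) auto
  then show ?thesis
    by (auto simp: affine_variety_def affine_space_def zariski_closed_UNIV inj_on_def vec_eq_iff)
qed

lemma affine_variety_prod:
  assumes V: "affine_variety V" and W: "affine_variety W"
  shows "affine_variety (V \<times>\<^sub>V W)"
proof -
  let ?X = "coord V ` points V" and ?Y = "coord W ` points W"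
  \<comment> \<open>The product is the intersection of two cylinders, the preimages of the factors
    under the coordinate projections.\<close>
  have image: "coord (V \<times>\<^sub>V W) ` points (V \<times>\<^sub>V W) =
      (\<lambda>z i. z (Inl i)) -` ?X \<inter> (\<lambda>z j. z (Inr j)) -` ?Y" (is "?L = ?R")
  proof
    show "?L \<subseteq> ?R"
      by (auto simp: variety_prod_def)
    show "?R \<subseteq> ?L"
    proof
      fix z assume "z \<in> ?R"
      then obtain v w where vw: "v \<in> points V" "w \<in> points W"
        and "\<And>i. z (Inl i) = coord V v i" "\<And>j. z (Inr j) = coord W w j"
        by (auto simp: fun_eq_iff)
      then have "z = case_sum (coord V v) (coord W w)"
        by (auto simp: fun_eq_iff split: sum.split)
      then show "z \<in> ?L"
        using vw by (force simp: variety_prod_def)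
    qed
  qed
  have "inj_on (coord (V \<times>\<^sub>V W)) (points (V \<times>\<^sub>V W))"
    using V W by (auto simp: affine_variety_def variety_prod_def inj_on_def elim!: case_sum_inject)
  moreover have "zariski_closed ?R"
    using V W unfolding affine_variety_def
    by (intro zariski_closed_Int zariski_closed_vimage polynomial_fun_intros) auto
  ultimately show ?thesis
    by (simp add: affine_variety_def image)
qed

text \<open>The function \<open>h j\<close> describes the target coordinate \<open>j\<close> in
  terms of the source coordinates; the polynomials representing the \<open>h j\<close> are chosen
  here once and for all.\<close>

lemma morphismI:
  assumes "\<And>v. v \<in> points V \<Longrightarrow> f v \<in> points W"
    and "\<And>j. polynomial_fun (h j)"
    and "\<And>v j. v \<in> points V \<Longrightarrow> coord W (f v) j = h j (coord V v)"
  shows "morphism V W f"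
proof -
  obtain P where "\<And>j. poly_eval (P j) = h j"
    using assms(2) unfolding polynomial_fun_def by metis
  then show ?thesis
    using assms(1,3) unfolding morphism_def by metis
qed


section \<open>Scalar matrices and the trace\<close>

lemma map_matrix_scale_mat_1: "map_matrix ((*) c) (mat 1) = mat (c :: 'k::comm_ring_1)"
  by (simp add: map_matrix_def mat_def vec_eq_iff)

lemma matrix_add_rdistrib: "(A + B) ** C = A ** C + B ** (C :: 'k::semiring_1 ^ 'm ^ 'n)"
  by (simp add: matrix_matrix_mult_def vec_eq_iff distrib_right sum.distrib)

lemma mat_matrix_mult_commute: "mat c ** A = A ** mat c"
  for c :: "'k::comm_ring_1" and A :: "'k ^ 'n ^ 'n"
  by (simp add: matrix_matrix_mult_def mat_def vec_eq_iff if_distrib if_distribR mult.commute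
      cong: if_cong)

lemma trace_mat: "trace (mat c :: 'k::comm_ring_1 ^ 'n ^ 'n) = of_nat CARD('n) * c"
  by (simp add: trace_def mat_def)

lemma lie_bracket_add_mat: "lie_bracket (A + mat a) (B + mat b) = lie_bracket A B"
  \<comment> \<open>One instance for each pair of cross terms of the expanded bracket, the last one
    for the product of the two scalar matrices.\<close>
  using mat_matrix_mult_commute[of a B] mat_matrix_mult_commute[of b A]
    mat_matrix_mult_commute[of a "mat b"]
  by (simp add: lie_bracket_def matrix_add_ldistrib matrix_add_rdistrib)

lemma lie_bracket_diff_mat: "lie_bracket (A - mat a) (B - mat b) = lie_bracket A B"
  using lie_bracket_add_mat[of "A - mat a" a "B - mat b" b] by simp

lemma polynomial_fun_mat_nth [polynomial_fun_intros]:
  assumes "polynomial_fun c"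
  shows "polynomial_fun (\<lambda>x. (mat (c x) :: 'k::comm_semiring_1 ^ 'n ^ 'n) $ i $ j)"
  using assms by (cases "i = j") (auto simp: mat_def intro: polynomial_fun_intros)


section \<open>The splitting of the commuting variety\<close>

text \<open>The coordinate image is an intersection of preimages of the closed set given by \<gg>,
  one per component, with zero sets of the quadratic entries of the brackets.\<close>

lemma affine_variety_commuting_variety:
  fixes \<gg> :: "('k::alg_closed_field ^ 'n::finite ^ 'n) set"
  assumes closed: "zariski_closed {y :: 'n \<times> 'n \<Rightarrow> 'k. (\<chi> i j. y (i, j)) \<in> \<gg>}"
  shows "affine_variety (commuting_variety \<gg> :: ('k ^ 'n ^ 'n ^ 'r::finite, _, 'k) variety)"
proof -
  let ?V = "commuting_variety \<gg> :: ('k ^ 'n ^ 'n ^ 'r, _, 'k) variety"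
  let ?t = "\<lambda>(x :: 'r \<times> 'n \<times> 'n \<Rightarrow> 'k) l. (\<chi> i j. x (l, i, j)) :: 'k ^ 'n ^ 'n"
  have image: "coord ?V ` points ?V =
      {x. (\<forall>l. ?t x l \<in> \<gg>) \<and> (\<forall>l m i j. lie_bracket (?t x l) (?t x m) $ i $ j = 0)}"
    (is "?L = ?R")
  proof
    show "?L \<subseteq> ?R"
      by (auto simp: commuting_variety_def)
    show "?R \<subseteq> ?L"
    proof
      fix x assume "x \<in> ?R"
      \<comment> \<open>The point above \<open>x\<close> is the tuple of matrices reassembled from
        its coordinates.\<close>
      then have "(\<chi> l. ?t x l) \<in> points ?V"
        by (auto simp: commuting_variety_def vec_eq_iff)
      moreover have "x = coord ?V (\<chi> l. ?t x l)"
        by (auto simp: commuting_variety_def)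
      ultimately show "x \<in> ?L"
        by blast
    qed
  qed
  have "zariski_closed {x. ?t x l \<in> \<gg>}" for l
    using zariski_closed_vimage[OF closed, of "\<lambda>x (i, j). x (l, i, j)"]
    by (auto simp: vimage_def intro: polynomial_fun_intros)
  moreover have "zariski_closed {x. lie_bracket (?t x l) (?t x m) $ i $ j = 0}" for l m i j
    by (rule zariski_closed_zeros)
      (auto simp: lie_bracket_def matrix_matrix_mult_def intro!: polynomial_fun_intros)
  ultimately have "zariski_closed ?R"
    by (intro zariski_closed_conj zariski_closed_all)
  moreover have "inj_on (coord ?V) (points ?V)"
    by (auto simp: commuting_variety_def inj_on_def vec_eq_iff fun_eq_iff)
  ultimately show ?thesis
    by (simp add: affine_variety_def image)
qed

text \<open>The inverse of the splitting: it puts back the scalar part determined by the prescribed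
  trace.\<close>

definition trace_merging ::
  "('k::field ^ 'n ^ 'n ^ 'r) \<times> ('k ^ 'r) \<Rightarrow> 'k ^ 'n ^ 'n ^ 'r" where
  "trace_merging = (\<lambda>(w, t). \<chi> l. w $ l + mat (t $ l / of_nat CARD('n)))"

lemma trace_splitting_eq:
  "trace_splitting (v :: 'k::field ^ 'n ^ 'n ^ 'r) =
     ((\<chi> l. v $ l - mat (trace (v $ l) / of_nat CARD('n))), (\<chi> l. trace (v $ l)))"
  by (simp add: trace_splitting_def map_matrix_scale_mat_1)

lemma trace_merging_splitting: "trace_merging (trace_splitting v) = v"
  by (simp add: trace_merging_def trace_splitting_eq vec_eq_iff)

text \<open>The merged component has trace \<open>0 + n * (t $ l / n) = t $ l\<close>, with
  \<open>n\<close> the matrix size; this uses both that \<open>w $ l\<close> is traceless and that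
  \<open>n\<close> is invertible.\<close>

lemma trace_splitting_merging:
  fixes w :: "'k::field ^ 'n ^ 'n ^ 'r"
  assumes "(of_nat CARD('n) :: 'k) \<noteq> 0" "\<And>l. w $ l \<in> sl"
  shows "trace_splitting (trace_merging (w, t)) = (w, t)"
  using assms by (simp add: trace_merging_def trace_splitting_eq vec_eq_iff trace_add
      trace_mat sl_def)

section \<open>Both maps are morphisms\<close>

lemma morphism_trace_splitting:
  assumes "(of_nat CARD('n) :: 'k::alg_closed_field) \<noteq> 0"
  shows "morphism (commuting_variety gl) (commuting_variety sl \<times>\<^sub>V affine_space)
    (trace_splitting :: 'k ^ 'n::finite ^ 'n ^ 'r::finite \<Rightarrow> _)"
proof -
  \<comment> \<open>\<open>T l\<close> is the trace of component \<open>l\<close> read off from the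
    coordinates. In \<open>h\<close>, the left summand gives the entries of the traceless parts and
    the right one the traces.\<close>
  define T :: "'r \<Rightarrow> ('r \<times> 'n \<times> 'n \<Rightarrow> 'k) \<Rightarrow> 'k" where "T l x = (\<Sum>i\<in>UNIV. x (l, i, i))" for l x
  define h :: "('r \<times> 'n \<times> 'n) + 'r \<Rightarrow> ('r \<times> 'n \<times> 'n \<Rightarrow> 'k) \<Rightarrow> 'k" where
    "h = case_sum
       (\<lambda>(l, i, j) x. x (l, i, j) - (mat (T l x / of_nat CARD('n)) :: 'k ^ 'n ^ 'n) $ i $ j) T"
  have T: "polynomial_fun (T l)" for l
    unfolding T_def by (intro polynomial_fun_intros)
  show ?thesis
  proof (rule morphismI)
    fix v :: "'k ^ 'n ^ 'n ^ 'r"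
    assume "v \<in> points (commuting_variety gl)"
    then show "trace_splitting v \<in> points (commuting_variety sl \<times>\<^sub>V affine_space)"
      \<comment> \<open>Invertibility of \<open>n\<close> gives trace zero:
        \<open>trace (v $ l) - n * (trace (v $ l) / n) = 0\<close>.\<close>
      using assms
      by (simp add: commuting_variety_def variety_prod_def affine_space_def trace_splitting_eq
          sl_def lie_bracket_diff_mat trace_sub trace_mat)
  next
    fix a show "polynomial_fun (h a)"
      by (auto simp: h_def split: sum.split intro!: polynomial_fun_intros T)
  next
    fix v :: "'k ^ 'n ^ 'n ^ 'r" and a
    show "coord (commuting_variety sl \<times>\<^sub>V affine_space) (trace_splitting v) a =
        h a (coord (commuting_variety gl) v)"
      by (auto simp: h_def T_def trace_def commuting_variety_def variety_prod_def affine_space_def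
          trace_splitting_eq split: sum.split)
  qed
qed

lemma morphism_trace_merging:
  "morphism (commuting_variety sl \<times>\<^sub>V affine_space) (commuting_variety gl)
    (trace_merging :: _ \<Rightarrow> 'k::alg_closed_field ^ 'n::finite ^ 'n ^ 'r::finite)"
proof (rule morphismI)
  fix z :: "('k ^ 'n ^ 'n ^ 'r) \<times> ('k ^ 'r)"
  assume "z \<in> points (commuting_variety sl \<times>\<^sub>V affine_space)"
  then show "trace_merging z \<in> points (commuting_variety gl)"
    by (auto simp: commuting_variety_def variety_prod_def gl_def trace_merging_def
        lie_bracket_add_mat)
next
  fix a :: "'r \<times> 'n \<times> 'n"
  show "polynomial_fun ((\<lambda>(l, i, j) x. x (Inl (l, i, j)) +
      (mat (x (Inr l) / of_nat CARD('n)) :: 'k ^ 'n ^ 'n) $ i $ j) a)"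
    by (auto split: prod.split intro!: polynomial_fun_intros)
next
  fix z :: "('k ^ 'n ^ 'n ^ 'r) \<times> ('k ^ 'r)" and a
  show "coord (commuting_variety gl) (trace_merging z) a =
      (\<lambda>(l, i, j) x. x (Inl (l, i, j)) +
        (mat (x (Inr l) / of_nat CARD('n)) :: 'k ^ 'n ^ 'n) $ i $ j) a
      (coord (commuting_variety sl \<times>\<^sub>V affine_space) z)"
    by (auto simp: commuting_variety_def variety_prod_def affine_space_def trace_merging_def
        split: prod.split)
qed

theorem theorem4p2p1:
  assumes "\<not> CHAR('k::alg_closed_field) dvd CARD('n::finite)"
  shows "variety_isomorphism
           (commuting_variety (gl :: ('k ^ 'n ^ 'n) set))
           (commuting_variety (sl :: ('k ^ 'n ^ 'n) set) \<times>\<^sub>V affine_space)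
           (trace_splitting :: 'k ^ 'n ^ 'n ^ 'r::finite \<Rightarrow> ('k ^ 'n ^ 'n ^ 'r) \<times> ('k ^ 'r))"
proof -
  \<comment> \<open>Characteristic 0 is covered as well: 0 divides only 0, and
    \<open>CARD('n)\<close> is positive.\<close>
  have n: "(of_nat CARD('n) :: 'k) \<noteq> 0"
    using assms by (simp add: of_nat_eq_0_iff_char_dvd)
  have "affine_variety (commuting_variety (gl :: ('k ^ 'n ^ 'n) set)
      :: ('k ^ 'n ^ 'n ^ 'r, _, 'k) variety)"
    by (rule affine_variety_commuting_variety) (simp add: gl_def zariski_closed_UNIV)
  moreover have "affine_variety (commuting_variety (sl :: ('k ^ 'n ^ 'n) set)
      :: ('k ^ 'n ^ 'n ^ 'r, _, 'k) variety)"
    by (rule affine_variety_commuting_variety)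
      \<comment> \<open>Membership in \<open>sl\<close> is the single linear equation saying that
        the trace vanishes.\<close>
      (auto simp: sl_def trace_def intro!: zariski_closed_zeros polynomial_fun_intros)
  moreover have "trace_splitting (trace_merging z) = z"
    if "z \<in> points (commuting_variety sl \<times>\<^sub>V affine_space)" for z :: "('k ^ 'n ^ 'n ^ 'r) \<times> ('k ^ 'r)"
    using that n
    by (cases z) (auto simp: variety_prod_def commuting_variety_def intro!: trace_splitting_merging)
  ultimately show ?thesis
    unfolding variety_isomorphism_def
    using morphism_trace_splitting[OF n] morphism_trace_merging trace_merging_splitting
    by (blast intro: affine_variety_prod affine_variety_affine_space)
qed

end
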